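(* Let $p$ be an odd prime, $n\ge 1$ an integer, $q=p^n$, and let $\zeta$ be a primitive $p$-th root of unity. For $a\in\mathbb{F}_q$ define the Kloosterman sum $\mathcal{K}_q(a)=\sum_{x\in\mathbb{F}_q}\zeta^{\mathrm{Tr}(x^{-1}+ax)}$, where $0^{-1}$ is interpreted as $0$ and $\mathrm{Tr}:\mathbb{F}_q\to\mathbb{F}_p$ is the absolute trace $\mathrm{Tr}(c)=c+c^p+\dots+c^{p^{n-1}}$. Then for every $a\in\mathbb{F}_q$, the product $\prod_{i=1}^{(p-1)/2}\mathcal{K}_q(i^2a)$ is a rational integer and \[\prod_{i=1}^{\frac{p-1}{2}}\mathcal{K}_q(i^2a)\equiv p\left(\frac{\mathrm{Tr}(a)}{p}\right)\pmod{p^2},\] where $\left(\frac{\cdot}{p}\right)$ is the Legendre symbol (with $\left(\frac{0}{p}\right)=0$).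
   Context: Here $i^2a$ denotes the element $i^2\cdot a$ of $\mathbb{F}_q$ with the integer $i$ reduced modulo $p$. The values $\mathcal{K}_q(i^2a)$, $1\le i\le (p-1)/2$, are the Galois conjugates of $\mathcal{K}_q(a)$ over $\mathbb{Q}$.
   Formalization: The case q = 3 is excluded, because the congruence fails there: for p = 3, n = 1, a = 1 the product is 1+ζ+ζ² = 0, whereas p(Tr(a)/p) = 3 is not 0 modulo 9. *)

theory Defs
  imports Complex_Main "HOL-Library.Cardinality" "HOL-Number_Theory.Number_Theory"
begin

(* The field with q = p ^ n elements is an arbitrary type 'a :: {field, finite} with
   CARD('a) = p ^ n.  In the class field, inverse 0 = 0, which is the convention used in the
   Kloosterman sum. *)

definition primitive_root_of_unity :: "nat \<Rightarrow> complex \<Rightarrow> bool" where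
  "primitive_root_of_unity m z \<longleftrightarrow> 0 < m \<and> z ^ m = 1 \<and> (\<forall>k. 0 < k \<and> k < m \<longrightarrow> z ^ k \<noteq> 1)"

definition abs_trace :: "nat \<Rightarrow> nat \<Rightarrow> 'a::field \<Rightarrow> 'a" where
  "abs_trace p n c = (\<Sum>k<n. c ^ (p ^ k))"

(* The identification of the prime field of 'a with {0, ..., p - 1}.  The description is
   well defined for u in the prime field when 'a has characteristic p, as is the case for
   all values of the absolute trace. *)
definition prime_field_rep :: "nat \<Rightarrow> 'a::field \<Rightarrow> nat" where
  "prime_field_rep p u = (THE t. t < p \<and> of_nat t = u)"

definition Tr :: "nat \<Rightarrow> nat \<Rightarrow> 'a::field \<Rightarrow> nat" where
  "Tr p n c = prime_field_rep p (abs_trace p n c)"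

definition kloosterman :: "nat \<Rightarrow> nat \<Rightarrow> complex \<Rightarrow> 'a::{field,finite} \<Rightarrow> complex" where
  "kloosterman p n \<zeta> a = (\<Sum>x\<in>UNIV. \<zeta> ^ Tr p n (inverse x + a * x))"

(* The congruence is false for q = 3, where the product has the single factor
   K_3(1) = 1 + \<zeta> + \<zeta>^2 = 0 at a = 1, while 3 (1/3) = 3 is not divisible by 9. *)
lemma kloosterman_congruence_fails_3:
  fixes \<zeta> :: complex
  assumes card: "CARD('a::{field,finite}) = 3" and prim: "primitive_root_of_unity 3 \<zeta>"
  shows "\<not> (\<exists>m::int.
           (\<Prod>i=1..(3 - 1) div 2. kloosterman 3 1 \<zeta> (of_nat (i\<^sup>2) * (1::'a))) = of_int m
         \<and> [m = int 3 * Legendre (int (Tr 3 1 (1::'a))) (int 3)] (mod (int 3)\<^sup>2))"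
proof -
  have two: "(2::'a) \<noteq> 0"
  proof
    assume "(2::'a) = 0"
    then have two0: "x + x = 0" for x :: 'a
      by (metis mult_2 mult_zero_left)
    have "\<not> (UNIV :: 'a set) \<subseteq> {0, 1}"
    proof
      assume "(UNIV :: 'a set) \<subseteq> {0, 1}"
      then have "card (UNIV :: 'a set) \<le> card {0, 1 :: 'a}" by (intro card_mono) auto
      then show False using card by simp
    qed
    then obtain z :: 'a where z: "z \<noteq> 0" "z \<noteq> 1" by auto
    have "z + 1 \<noteq> 0" using two0[of 1] z by (metis add_right_cancel)
    then have "card {0, 1, z, z + 1} = 4" using z by simp
    moreover have "card {0, 1, z, z + 1} \<le> card (UNIV :: 'a set)" by (intro card_mono) auto
    ultimately show False using card by simp
  qed
  have "(2::'a) = 1 + 1" by simp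
  then have ne: "(1::'a) \<noteq> 2" "(2::'a) \<noteq> 1" by (metis add_cancel_right_right one_neq_zero)+
  then have "card {0, 1, 2 :: 'a} = 3" using two two[symmetric] by simp
  then have UN: "(UNIV :: 'a set) = {0, 1, 2}"
    using card by (metis card_subset_eq finite subset_UNIV)
  have three: "(3::'a) = 0"
  proof -
    have "(3::'a) = 1 + 2" "(3::'a) = 2 + 1" by simp_all
    then have "(3::'a) \<noteq> 1" "(3::'a) \<noteq> 2"
      using two by (metis add_cancel_left_right, metis add_cancel_left_right one_neq_zero)
    then show ?thesis using UN by blast
  qed
  have "(4::'a) = 3 + 1" by simp
  then have four: "(4::'a) = 1" unfolding three by simp
  have inv2: "inverse (2::'a) = 2" by (rule inverse_unique) (simp add: four)
  have arg: "inverse 0 + 1 * 0 = (0::'a)" "inverse 1 + 1 * 1 = (2::'a)" "inverse 2 + 1 * 2 = (1::'a)"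
    unfolding inv2 by (simp_all add: four)
  have lt3: "t < 3 \<longleftrightarrow> t = 0 \<or> t = 1 \<or> t = 2" for t :: nat by auto
  have T: "Tr 3 1 (0::'a) = 0" "Tr 3 1 (1::'a) = 1" "Tr 3 1 (2::'a) = 2"
    unfolding Tr_def abs_trace_def prime_field_rep_def
    by (rule the_equality; use two ne in \<open>auto simp: lt3\<close>)+
  have "\<zeta> ^ 3 = 1" "\<zeta> ^ 1 \<noteq> 1"
    using prim unfolding primitive_root_of_unity_def by (auto simp del: power_one_right)
  moreover have "(\<zeta> - 1) * (1 + \<zeta> + \<zeta>\<^sup>2) = \<zeta> ^ 3 - 1"
    by (simp add: algebra_simps power2_eq_square power3_eq_cube)
  ultimately have z: "1 + \<zeta> + \<zeta>\<^sup>2 = 0" by simp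
  have "kloosterman 3 1 \<zeta> (1::'a) =
      \<zeta> ^ Tr 3 1 (inverse 0 + 1 * 0 :: 'a) + (\<zeta> ^ Tr 3 1 (inverse 1 + 1 * 1 :: 'a)
        + \<zeta> ^ Tr 3 1 (inverse 2 + 1 * 2 :: 'a))"
    unfolding kloosterman_def UN using two two[symmetric] ne by (simp del: inverse_eq_divide_numeral)
  also have "\<dots> = 0" unfolding arg T using z by (simp add: add_ac)
  finally have "kloosterman 3 1 \<zeta> (1::'a) = 0" .
  moreover have "Legendre 1 3 = 1"
    by (auto simp: Legendre_def QuadRes_def cong_def intro: exI[of _ 1])
  ultimately show ?thesis using T by (simp add: cong_def)
qed

end

theory Submission
  imports Defs "HOL-Computational_Algebra.Polynomial"
begin

text \<open>
  Write \<open>T(x) = Tr(x\<^bsup>-1\<^esup> + a x)\<close>, \<open>\<lambda> = (1 - \<zeta>) (1 - \<zeta>\<^bsup>-1\<^esup>)\<close> and \<open>h = (p - 1) / 2\<close>. Pairing \<open>x\<close> with \<open>-x\<close> gives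
  \<open>2 K(a) = 2 q - (\<Sum>x. (1 - \<zeta>\<^bsup>T(x)\<^esup>) (1 - \<zeta>\<^bsup>-T(x)\<^esup>))\<close>, and each summand is \<open>\<lambda> T(x)\<^sup>2\<close> modulo \<open>\<lambda> (1 - \<zeta>)\<close>.
  The power sums of the finite field give \<open>(\<Sum>x. T(x)\<^sup>2) \<equiv> -2 Tr(a)\<close> modulo \<open>p\<close>, hence
  \<open>K(a) \<equiv> \<lambda> Tr(a)\<close> modulo \<open>\<lambda> (1 - \<zeta>)\<close>. The conjugates of \<open>\<lambda>\<close> multiply to \<open>p\<close>, so the norm of \<open>K(a)\<close> is
  \<open>p Tr(a)\<^sup>h\<close> modulo \<open>p\<^sup>2\<close>, and Euler's criterion turns \<open>Tr(a)\<^sup>h\<close> into the Legendre symbol.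
\<close>

section \<open>Roots of unity of prime order\<close>

lemma root_of_unity_power_cong:
  fixes z :: "'b::comm_ring_1"
  assumes "z ^ p = 1" "[a = b] (mod p)"
  shows "z ^ a = z ^ b"
proof -
  have "z ^ k = z ^ (k mod p)" for k
  proof -
    have "z ^ (p * (k div p) + k mod p) = z ^ (k mod p)"
      by (simp only: power_add power_mult assms(1) power_one mult_1)
    then show ?thesis by simp
  qed
  from this[of a] this[of b] assms(2) show ?thesis by (simp add: cong_def)
qed

text \<open>\<open>k\<close> has an inverse \<open>l\<close> modulo \<open>p\<close>, so
  \<open>z ^ k = 1\<close> would give \<open>z = z ^ (k * l) = 1\<close>.\<close>

lemma prime_root_of_unity_power_ne_1:
  fixes z :: "'b::comm_ring_1"
  assumes "prime p" "z ^ p = 1" "z \<noteq> 1" "\<not> p dvd k"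
  shows "z ^ k \<noteq> 1"
proof
  assume k: "z ^ k = 1"
  have "coprime k p" using assms(1,4) by (metis coprime_commute prime_imp_coprime)
  then obtain l where "[k * l = 1] (mod p)" using cong_solve_coprime_nat by fastforce
  then have "z ^ (k * l) = z ^ 1" by (rule root_of_unity_power_cong[OF assms(2)])
  then show False using k assms(3) by (simp add: power_mult)
qed

lemma prime_root_of_unity_inj_on:
  fixes z :: "'b::field"
  assumes "prime p" "z ^ p = 1" "z \<noteq> 1"
  shows "inj_on (\<lambda>k. z ^ k) {..<p}"
proof (rule linorder_inj_onI')
  fix i j assume ij: "i \<in> {..<p}" "j \<in> {..<p}" "i < j"
  have "\<not> p dvd j - i" using ij by (auto dest: dvd_imp_le)
  then have ne: "z ^ (j - i) \<noteq> 1" using assms by (intro prime_root_of_unity_power_ne_1)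
  have "z \<noteq> 0" using assms(2) prime_gt_0_nat[OF assms(1)] by (auto simp: power_0_left)
  moreover have "z ^ j = z ^ i * z ^ (j - i)" using ij by (simp flip: power_add)
  ultimately show "z ^ i \<noteq> z ^ j" using ne by simp
qed

lemma sum_power_root_of_unity:
  fixes z :: "'b::idom"
  assumes "z ^ p = 1" "z \<noteq> 1"
  shows "(\<Sum>k<p. z ^ k) = 0"
  using sum_gp_basic[of z "p - 1"] assms by (cases p) (auto simp: lessThan_Suc_atMost)

text \<open>The powers \<open>z ^ 1\<close>, ..., \<open>z ^ (p - 1)\<close> are distinct roots of
  \<open>1 + X + ... + X ^ (p - 1)\<close>, so this polynomial is the product of the
  \<open>X - z ^ k\<close>; evaluate at 1.\<close>

lemma prod_one_minus_root_of_unity: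
  fixes z :: "'b::field"
  assumes "prime p" "z ^ p = 1" "z \<noteq> 1"
  shows "(\<Prod>k=1..p-1. 1 - z ^ k) = of_nat p"
proof -
  define P where "P = (\<Prod>k=1..p-1. [:- (z ^ k), 1:])"
  define S where "S = (\<Sum>k<p. monom (1::'b) k)"
  have p: "p > 1" using assms(1) by (rule prime_gt_1_nat)
  have degP: "degree P = p - 1"
    unfolding P_def by (subst degree_prod_eq_sum_degree) auto
  have lcP: "coeff P (p - 1) = 1"
    using degP unfolding P_def by (metis (no_types, lifting) lead_coeff_prod lead_coeff_pCons(1) one_pCons pCons_eq_0_iff prod.neutral coeff_pCons_0 degree_pCons_0 zero_neq_one)
  have coeffS: "coeff S k = (if k < p then 1 else 0)" for k
    by (simp add: S_def coeff_sum)
  have inj: "inj_on (\<lambda>k. z ^ k) {1..p-1}"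
    by (rule inj_on_subset[OF prime_root_of_unity_inj_on[OF assms]]) (use p in auto)
  have "P = S"
  proof (rule poly_eqI_degree_lead_coeff[where A = "(\<lambda>k. z ^ k) ` {1..p-1}" and n = "p - 1"])
    show "coeff P (p - 1) = coeff S (p - 1)" using lcP coeffS p by simp
    show "card ((\<lambda>k. z ^ k) ` {1..p-1}) \<ge> p - 1" using inj by (simp add: card_image)
    show "degree P \<le> p - 1" using degP by simp
    show "degree S \<le> p - 1" by (rule degree_le) (use coeffS in auto)
    fix x assume "x \<in> (\<lambda>k. z ^ k) ` {1..p-1}"
    then obtain k where k: "k \<in> {1..p-1}" "x = z ^ k" by auto
    have "poly P x = 0" unfolding P_def poly_prod using k by (intro prod_zero) auto
    moreover have "x ^ p = 1" using assms(2) k by (metis power_commutes power_mult power_one mult.commute)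
    moreover have "x \<noteq> 1" unfolding k(2) using k p
      by (intro prime_root_of_unity_power_ne_1[OF assms]) (auto dest!: dvd_imp_le)
    ultimately show "poly P x = poly S x"
      unfolding S_def by (simp add: poly_sum poly_monom sum_power_root_of_unity)
  qed
  then have "poly P 1 = poly S 1" by simp
  then show ?thesis unfolding P_def S_def by (simp add: poly_prod poly_sum poly_monom)
qed

text \<open>As in Gauss' lemma, multiplication by \<open>j\<close> permutes \<open>{1, \<dots>, (p - 1) / 2}\<close> up to sign modulo \<open>p\<close>.\<close>
lemma prod_half_system:
  fixes f :: "nat \<Rightarrow> 'b::comm_monoid_mult"
  assumes p: "prime p" "odd p" and j: "\<not> p dvd j"
    and per: "\<And>a b. [a = b] (mod p) \<Longrightarrow> f a = f b"
    and ev: "\<And>a. f ((p - 1) * a) = f a"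
  shows "(\<Prod>i=1..(p-1) div 2. f (i * j)) = (\<Prod>i=1..(p-1) div 2. f i)"
proof -
  define h where "h = (p - 1) div 2"
  have ph: "p = 2 * h + 1" using p(2) by (auto simp: h_def elim!: oddE)
  define \<rho> where "\<rho> i = (if i * j mod p \<le> h then i * j mod p else p - i * j mod p)" for i
  have ndvd: "\<not> p dvd i * j" if "i \<in> {1..h}" for i
    using that p(1) j ph by (auto simp: prime_dvd_mult_iff dest: dvd_imp_le)
  have cases: "[\<rho> i = i * j] (mod p) \<or> [\<rho> i + i * j = 0] (mod p)" for i
  proof (cases "i * j mod p \<le> h")
    case False
    have "i * j mod p < p" using ph by simp
    then have "\<rho> i + i * j mod p = p" using False by (simp add: \<rho>_def)
    then have "(\<rho> i + i * j) mod p = 0" by (metis mod_add_right_eq mod_self)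
    then show ?thesis by (simp add: cong_def)
  qed (simp add: \<rho>_def cong_def)
  have mem: "\<rho> i \<in> {1..h}" if "i \<in> {1..h}" for i
  proof -
    have "i * j mod p > 0" using ndvd[OF that] by (simp add: mod_greater_zero_iff_not_dvd)
    moreover have "i * j mod p < p" using ph by simp
    moreover have "p \<le> 2 * h + 1" using ph by simp
    ultimately show ?thesis by (auto simp: \<rho>_def)
  qed
  have inj: "inj_on \<rho> {1..h}"
  proof (rule inj_onI)
    fix i k assume ik: "i \<in> {1..h}" "k \<in> {1..h}" "\<rho> i = \<rho> k"
    have cop: "coprime j p" using p(1) j by (metis coprime_commute prime_imp_coprime)
    \<comment> \<open>Equal representatives force \<open>i * j\<close> and \<open>k * j\<close> to
      agree up to sign; opposite signs are excluded by \<open>0 < i + k < p\<close>.\<close>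
    consider "[i * j = k * j] (mod p)" | "[(i + k) * j = 0] (mod p)"
      using cases[of i] cases[of k] ik(3)
      by (smt (verit) add.commute add_mult_distrib cong_add_lcancel_nat cong_add cong_refl cong_sym cong_trans)
    then show "i = k"
    proof cases
      case 1
      then have "[i = k] (mod p)" using cop by (simp add: cong_mult_rcancel_nat)
      then show ?thesis using ik ph by (intro cong_less_modulus_unique_nat) auto
    next
      case 2
      then have "p dvd i + k" using p(1) j by (simp add: cong_0_iff prime_dvd_mult_iff)
      then show ?thesis using ik ph by (auto dest!: dvd_imp_le)
    qed
  qed
  have bij: "bij_betw \<rho> {1..h} {1..h}"
    using inj mem by (metis bij_betw_def card_image card_subset_eq finite_atLeastAtMost image_subsetI)
  have "f (i * j) = f (\<rho> i)" for i
    using cases[of i]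
  proof
    assume "[\<rho> i + i * j = 0] (mod p)"
    then have "p dvd \<rho> i + i * j" by (simp add: cong_0_iff)
    \<comment> \<open>The factor \<open>p - 1\<close> acts as -1 modulo \<open>p\<close>, so
      \<open>ev\<close> is evenness and absorbs the sign.\<close>
    then have "[(p - 1) * (i * j) = \<rho> i] (mod p)"
    proof -
      have "[(p - 1) * (i * j) + i * j = \<rho> i + i * j] (mod p)"
        using \<open>p dvd \<rho> i + i * j\<close> ph by (simp add: cong_def add.commute[of _ "i * j"] flip: add_mult_distrib mult_Suc)
      then show ?thesis by (simp add: cong_add_rcancel_nat)
    qed
    then show ?thesis using per ev by metis
  qed (use per in \<open>simp add: cong_sym_eq\<close>)
  then have "(\<Prod>i=1..h. f (i * j)) = (\<Prod>i=1..h. f (\<rho> i))" by simp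
  also have "\<dots> = (\<Prod>i=1..h. f i)" by (rule prod.reindex_bij_betw[OF bij])
  finally show ?thesis by (simp add: h_def)
qed

text \<open>The case \<open>k = 1\<close> makes \<open>x\<close> rational, say \<open>u / d\<close>
  in lowest terms. The case \<open>k = N\<close> makes \<open>d ^ N\<close> divide \<open>N\<close>,
  impossible for \<open>d \<ge> 2\<close> because \<open>N < 2 ^ N\<close>. This takes the place of
  an argument with algebraic integers.\<close>

lemma Ints_if_bounded_denominator_powers:
  fixes x :: "'b::field_char_0"
  assumes "N > 0" "\<And>k. of_nat N * x ^ k \<in> \<int>"
  shows "x \<in> \<int>"
proof -
  obtain b where b: "of_nat N * x = of_int b" using assms(2)[of 1] by (auto elim: Ints_cases)
  have "x = of_rat (of_int b / of_nat N)"
    using b assms(1) by (simp add: of_rat_divide field_simps)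
  then obtain r where r: "x = of_rat r" by blast
  obtain u d where ud: "quotient_of r = (u, d)" by fastforce
  have d: "d > 0" "coprime u d" "r = of_int u / of_int d"
    using quotient_of_denom_pos[OF ud] quotient_of_coprime[OF ud] quotient_of_div[OF ud] by auto
  have x: "x * of_int d = of_int u" using d by (simp add: r of_rat_divide)
  have "d ^ N dvd int N"
  proof -
    obtain c where "of_nat N * x ^ N = of_int c" using assms(2)[of N] by (auto elim: Ints_cases)
    then have "of_nat N * of_int u ^ N = (of_int c :: 'b) * of_int d ^ N"
      by (metis x power_mult_distrib mult.assoc)
    then have "int N * u ^ N = c * d ^ N"
      by (metis (mono_tags) of_int_eq_iff of_int_mult of_int_power of_int_of_nat_eq)
    then have "d ^ N dvd int N * u ^ N" by simp
    then show ?thesis using d(2) by (simp add: coprime_commute coprime_dvd_mult_left_iff)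
  qed
  then have "d ^ N \<le> int N" using assms(1) by (intro zdvd_imp_le) auto
  moreover have "2 ^ N \<le> d ^ N" if "d \<ge> 2" using that by (intro power_mono) auto
  moreover have "int N < 2 ^ N" by (metis of_nat_less_two_power)
  ultimately have "d = 1" using d(1) by linarith
  then show ?thesis using x by simp
qed

section \<open>Integer polynomial functions at roots of unity\<close>

text \<open>An element of the ring generated by a root of unity is kept as a function, so that one
  object has values at all conjugates and also at 1, where the value is its residue modulo
  \<open>1 - z\<close>.\<close>

definition int_poly_fun :: "(complex \<Rightarrow> complex) \<Rightarrow> bool" where
  "int_poly_fun f \<longleftrightarrow> (\<exists>P. (\<forall>i. coeff P i \<in> \<int>) \<and> f = poly P)"

lemma int_poly_fun_const: "c \<in> \<int> \<Longrightarrow> int_poly_fun (\<lambda>_. c)"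
  unfolding int_poly_fun_def
  by (rule exI[of _ "[:c:]"]) (auto simp: coeff_pCons split: nat.split)

lemma int_poly_fun_ident: "int_poly_fun (\<lambda>z. z)"
  unfolding int_poly_fun_def
  by (rule exI[of _ "[:0, 1:]"]) (auto simp: coeff_pCons split: nat.split)

lemma int_poly_fun_add:
  assumes "int_poly_fun f" "int_poly_fun g"
  shows "int_poly_fun (\<lambda>z. f z + g z)"
proof -
  obtain P Q where "\<forall>i. coeff P i \<in> \<int>" "f = poly P" "\<forall>i. coeff Q i \<in> \<int>" "g = poly Q"
    using assms unfolding int_poly_fun_def by blast
  then show ?thesis unfolding int_poly_fun_def by (intro exI[of _ "P + Q"]) auto
qed

lemma int_poly_fun_mult:
  assumes "int_poly_fun f" "int_poly_fun g"
  shows "int_poly_fun (\<lambda>z. f z * g z)"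
proof -
  obtain P Q where "\<forall>i. coeff P i \<in> \<int>" "f = poly P" "\<forall>i. coeff Q i \<in> \<int>" "g = poly Q"
    using assms unfolding int_poly_fun_def by blast
  then show ?thesis unfolding int_poly_fun_def
    by (intro exI[of _ "P * Q"]) (auto simp: coeff_mult intro!: Ints_sum Ints_mult)
qed

lemma int_poly_fun_diff:
  assumes "int_poly_fun f" "int_poly_fun g"
  shows "int_poly_fun (\<lambda>z. f z - g z)"
proof -
  have "int_poly_fun (\<lambda>z. f z + (- 1) * g z)"
    using assms by (intro int_poly_fun_add int_poly_fun_mult int_poly_fun_const) auto
  then show ?thesis by simp
qed

lemma int_poly_fun_sum:
  "(\<And>i. i \<in> A \<Longrightarrow> int_poly_fun (f i)) \<Longrightarrow> int_poly_fun (\<lambda>z. \<Sum>i\<in>A. f i z)"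
  by (induction A rule: infinite_finite_induct) (auto intro!: int_poly_fun_add int_poly_fun_const)

lemma int_poly_fun_prod:
  "(\<And>i. i \<in> A \<Longrightarrow> int_poly_fun (f i)) \<Longrightarrow> int_poly_fun (\<lambda>z. \<Prod>i\<in>A. f i z)"
  by (induction A rule: infinite_finite_induct) (auto intro!: int_poly_fun_mult int_poly_fun_const)

lemma int_poly_fun_power: "int_poly_fun f \<Longrightarrow> int_poly_fun (\<lambda>z. f z ^ k)"
  by (induction k) (auto intro!: int_poly_fun_mult int_poly_fun_const)

lemma int_poly_fun_compose:
  assumes "int_poly_fun f" "int_poly_fun g"
  shows "int_poly_fun (\<lambda>z. f (g z))"
proof -
  obtain P where P: "\<forall>i. coeff P i \<in> \<int>" "f = poly P"
    using assms(1) unfolding int_poly_fun_def by blast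
  have "int_poly_fun (\<lambda>z. \<Sum>i\<le>degree P. coeff P i * g z ^ i)"
    using P assms(2)
    by (intro int_poly_fun_sum int_poly_fun_mult int_poly_fun_const int_poly_fun_power) auto
  then show ?thesis by (simp add: P poly_altdef)
qed

lemma int_poly_fun_at_1: "int_poly_fun f \<Longrightarrow> f 1 \<in> \<int>"
  unfolding int_poly_fun_def by (auto simp: poly_altdef intro!: Ints_sum)

section \<open>Averages over conjugates and the norm\<close>

text \<open>Summing over all conjugates of \<open>\<zeta>\<close> and over \<open>1\<close> replaces every use of the linear independence of
  the powers of \<open>\<zeta>\<close> (irreducibility of the cyclotomic polynomial).\<close>
lemma int_poly_fun_sum_roots_of_unity:
  assumes p: "prime p" and \<zeta>: "\<zeta> ^ p = 1" "\<zeta> \<noteq> 1" and f: "int_poly_fun f"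
  obtains N :: int where "(\<Sum>j<p. f (\<zeta> ^ j)) = of_nat p * of_int N"
proof -
  obtain P where P: "\<forall>i. coeff P i \<in> \<int>" "f = poly P"
    using f unfolding int_poly_fun_def by blast
  \<comment> \<open>Orthogonality: only the monomials whose exponent is a multiple of
    \<open>p\<close> survive the sum.\<close>
  have 1: "(\<Sum>j<p. (\<zeta> ^ j) ^ i) = of_nat p * (if p dvd i then 1 else 0)" for i
  proof (cases "p dvd i")
    case True
    then have "(\<zeta> ^ j) ^ i = 1" for j
      using root_of_unity_power_cong[OF \<zeta>(1), of "j * i" 0]
      by (simp add: cong_0_iff flip: power_mult)
    then show ?thesis using True by simp
  next
    case False
    have "(\<Sum>j<p. (\<zeta> ^ i) ^ j) = 0"
      using \<zeta> False p
      by (intro sum_power_root_of_unity prime_root_of_unity_power_ne_1)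
         (simp_all add: power_mult mult.commute[of i] flip: power_mult[of \<zeta> i p])
    then show ?thesis using False by (simp add: mult.commute flip: power_mult)
  qed
  have "(\<Sum>j<p. f (\<zeta> ^ j)) = (\<Sum>i\<le>degree P. coeff P i * (\<Sum>j<p. (\<zeta> ^ j) ^ i))"
    unfolding P poly_altdef by (subst sum.swap) (simp add: sum_distrib_left)
  also have "\<dots> = of_nat p * (\<Sum>i\<le>degree P. coeff P i * (if p dvd i then 1 else 0))"
    unfolding 1 by (simp add: sum_distrib_left mult_ac)
  also have "(\<Sum>i\<le>degree P. coeff P i * (if p dvd i then 1 else 0)) \<in> \<int>"
    using P(1) by (intro Ints_sum) auto
  ultimately show ?thesis using that by (auto elim: Ints_cases)
qed

text \<open>The product \<open>g(\<zeta>)\<close> of the conjugates of \<open>f(\<zeta>)\<close> is the same for all \<open>\<zeta>\<^sup>j\<close>, so averaging over \<open>j\<close> gives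
  \<open>(p - 1) g(\<zeta>)\<^sup>k \<in> \<int>\<close> for every \<open>k\<close>; this bounds the denominators of all powers of \<open>g(\<zeta>)\<close>. The
  congruence results from averaging the factorization \<open>c\<^sup>h g(\<zeta>\<^sup>j) = p G(\<zeta>\<^sup>j)\<close> in the same way.\<close>
lemma int_poly_fun_norm_cong:
  fixes \<zeta> :: complex and f H :: "complex \<Rightarrow> complex" and c s :: int
  assumes p: "prime p" "odd p" and \<zeta>: "\<zeta> ^ p = 1" "\<zeta> \<noteq> 1"
    and f: "int_poly_fun f" and H: "int_poly_fun H"
    and even: "\<And>z. z ^ p = 1 \<Longrightarrow> f (z ^ (p - 1)) = f z"
    and fH: "\<And>z. z ^ p = 1 \<Longrightarrow> z \<noteq> 1 \<Longrightarrow> of_int c * f z = (1 - z) * (1 - z ^ (p - 1)) * H z"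
    and s: "H 1 = of_int s"
  obtains m :: int where "(\<Prod>i=1..(p-1) div 2. f (\<zeta> ^ i)) = of_int m"
    and "[c ^ ((p-1) div 2) * m = int p * s ^ ((p-1) div 2)] (mod (int p)\<^sup>2)"
proof -
  define h where "h = (p - 1) div 2"
  have ph: "p = 2 * h + 1" using p(2) by (auto simp: h_def elim!: oddE)
  have root: "(\<zeta> ^ i) ^ p = 1" for i
    using \<zeta>(1) by (simp add: mult.commute[of i] flip: power_mult) (simp add: power_mult)
  define g where "g z = (\<Prod>i=1..h. f (z ^ i))" for z
  define G where "G z = (\<Prod>i=1..h. H (z ^ i))" for z
  have g: "int_poly_fun g" and G: "int_poly_fun G"
    unfolding g_def G_def using f H
    by (auto intro!: int_poly_fun_prod int_poly_fun_compose[where g = "\<lambda>z. z ^ i" for i]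
        int_poly_fun_power int_poly_fun_ident)
  \<comment> \<open>The index 0 gives the value at 1; the conjugates of \<open>\<zeta>\<close> are
    indexed by \<open>1..<p\<close>.\<close>
  have split: "(\<Sum>j<p. F j) = F 0 + (\<Sum>j=1..<p. F j)" for F :: "nat \<Rightarrow> complex"
    using ph by (simp add: sum.lessThan_Suc_shift atLeast0LessThan sum.atLeast_Suc_lessThan flip: atLeast0LessThan)
  have ndvd: "\<not> p dvd j" if "j \<in> {1..<p}" for j using that by (auto dest: dvd_imp_le)
  have gj: "g (\<zeta> ^ j) = g \<zeta>" if "j \<in> {1..<p}" for j
  proof -
    have "g (\<zeta> ^ j) = (\<Prod>i=1..h. f (\<zeta> ^ (i * j)))"
      by (simp add: g_def mult.commute flip: power_mult)
    also have "\<dots> = g \<zeta>" unfolding g_def h_def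
    proof (rule prod_half_system[OF p ndvd[OF that]])
      show "f (\<zeta> ^ a) = f (\<zeta> ^ b)" if "[a = b] (mod p)" for a b
        using root_of_unity_power_cong[OF \<zeta>(1) that] by simp
      show "f (\<zeta> ^ ((p - 1) * a)) = f (\<zeta> ^ a)" for a
        using even[OF root[of a]] by (simp add: mult.commute flip: power_mult)
    qed
    finally show ?thesis .
  qed
  have bounded: "of_nat (p - 1) * g \<zeta> ^ k \<in> \<int>" for k
  proof -
    have gk: "int_poly_fun (\<lambda>z. g z ^ k)" using g by (rule int_poly_fun_power)
    obtain N :: int where "(\<Sum>j<p. g (\<zeta> ^ j) ^ k) = of_nat p * of_int N"
      using int_poly_fun_sum_roots_of_unity[OF p(1) \<zeta> gk] .
    moreover have "(\<Sum>j=1..<p. g (\<zeta> ^ j) ^ k) = of_nat (p - 1) * g \<zeta> ^ k"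
      using gj by simp
    ultimately have "of_nat (p - 1) * g \<zeta> ^ k = of_nat p * of_int N - g 1 ^ k"
      using split[of "\<lambda>j. g (\<zeta> ^ j) ^ k"] by (simp add: algebra_simps)
    also have "\<dots> \<in> \<int>" using int_poly_fun_at_1[OF gk] by (intro Ints_diff Ints_mult) auto
    finally show ?thesis .
  qed
  have "p - 1 > 0" using prime_gt_1_nat[OF p(1)] by simp
  then have "g \<zeta> \<in> \<int>" using bounded by (rule Ints_if_bounded_denominator_powers)
  then obtain m where m: "g \<zeta> = of_int m" by (auto elim: Ints_cases)
  have gG: "of_int c ^ h * g (\<zeta> ^ j) = of_nat p * G (\<zeta> ^ j)" if j: "j \<in> {1..<p}" for j
  proof -
    define w where "w = \<zeta> ^ j"
    have w: "w ^ p = 1" "w \<noteq> 1"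
      using root prime_root_of_unity_power_ne_1[OF p(1) \<zeta> ndvd[OF j]] by (auto simp: w_def)
    have "of_int c ^ h * g w = (\<Prod>i=1..h. of_int c * f (w ^ i))"
      by (simp add: g_def prod.distrib)
    also have "\<dots> = (\<Prod>i=1..h. (1 - w ^ i) * (1 - w ^ (p - i)) * H (w ^ i))"
    proof (rule prod.cong[OF refl])
      fix i assume i: "i \<in> {1..h}"
      have "w ^ i \<noteq> 1" using w i ph p(1)
        by (intro prime_root_of_unity_power_ne_1[OF p(1)]) (auto dest!: dvd_imp_le)
      moreover have "(w ^ i) ^ p = 1" using root[of "j * i"] by (simp add: w_def power_mult)
      moreover have "(w ^ i) ^ (p - 1) = w ^ (p - i)"
        unfolding power_mult[symmetric]
      proof (rule root_of_unity_power_cong[OF w(1)])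
        have "i * (p - 1) + i = p * i" using ph by simp
        moreover have "p - i + i = p" using i ph by simp
        ultimately have "[i * (p - 1) + i = p - i + i] (mod p)" by (simp add: cong_def)
        then show "[i * (p - 1) = p - i] (mod p)" by (simp add: cong_add_rcancel_nat)
      qed
      ultimately show "of_int c * f (w ^ i) = (1 - w ^ i) * (1 - w ^ (p - i)) * H (w ^ i)"
        using fH[of "w ^ i"] by simp
    qed
    also have "\<dots> = ((\<Prod>i=1..h. 1 - w ^ i) * (\<Prod>i=1..h. 1 - w ^ (p - i))) * G w"
      by (simp add: G_def prod.distrib)
    \<comment> \<open>Reflection turns the second product into the upper half of the indices, so
      both halves together give the full product, which is \<open>p\<close>.\<close>
    also have "(\<Prod>i=1..h. 1 - w ^ (p - i)) = (\<Prod>k=h+1..p-1. 1 - w ^ k)"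
      by (rule prod.reindex_bij_witness[of _ "\<lambda>k. p - k" "\<lambda>i. p - i"]) (use ph in auto)
    also have "(\<Prod>i=1..h. 1 - w ^ i) * (\<Prod>k=h+1..p-1. 1 - w ^ k) = (\<Prod>k=1..p-1. 1 - w ^ k)"
      by (subst prod.union_disjoint[symmetric]) (use ph in \<open>auto intro!: prod.cong\<close>)
    also have "\<dots> = of_nat p" by (rule prod_one_minus_root_of_unity[OF p(1) w])
    finally show ?thesis by (simp add: w_def)
  qed
  obtain N :: int where "(\<Sum>j<p. G (\<zeta> ^ j)) = of_nat p * of_int N"
    using int_poly_fun_sum_roots_of_unity[OF p(1) \<zeta> G] .
  then have N: "(\<Sum>j=1..<p. G (\<zeta> ^ j)) = of_nat p * of_int N - of_int s ^ h"
    using split[of "\<lambda>j. G (\<zeta> ^ j)"] by (simp add: G_def s algebra_simps)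
  have "of_nat (p - 1) * (of_int c ^ h * of_int m) = (\<Sum>j=1..<p. of_int c ^ h * g (\<zeta> ^ j))"
    using gj m by simp
  also have "\<dots> = of_nat p * (of_nat p * of_int N - of_int s ^ h)"
    using gG N by (simp flip: sum_distrib_left)
  finally have "of_int (int (p - 1) * (c ^ h * m)) = (of_int (int p * (int p * N - s ^ h)) :: complex)"
    by simp
  then have eq: "int (p - 1) * (c ^ h * m) = int p * (int p * N - s ^ h)"
    by (simp only: of_int_eq_iff)
  have p1: "int (p - 1) = int p - 1" using ph by simp
  define X where "X = c ^ h * m"
  \<comment> \<open>Solving \<open>(p - 1) * X = p * (p * N - s ^ h)\<close> for \<open>X\<close>
    shows that \<open>p\<close> divides \<open>X\<close>; fed back into the same equation, this
    yields the congruence modulo \<open>p ^ 2\<close>.\<close>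
  have X: "X = int p * (X - int p * N + s ^ h)"
    using eq unfolding p1 X_def[symmetric] by (simp add: algebra_simps)
  have "X - int p * s ^ h = int p * (X - int p * N)" using X by (simp add: algebra_simps)
  moreover have "int p dvd X - int p * N" using X by (metis dvd_diff dvd_triv_left)
  ultimately have "[X = int p * s ^ h] (mod (int p)\<^sup>2)"
    by (auto simp: cong_iff_dvd_diff power2_eq_square)
  then show ?thesis using that[of m] m by (simp add: g_def X_def h_def)
qed

section \<open>The absolute trace\<close>

lemma finite_field_power_card:
  fixes x :: "'a::{field,finite}"
  shows "x ^ CARD('a) = x"
proof (cases "x = 0")
  case False
  define U where "U = (UNIV - {0} :: 'a set)"
  have "(\<Prod>y\<in>U. y) = (\<Prod>y\<in>U. x * y)"
    by (rule prod.reindex_bij_witness[of _ "\<lambda>y. x * y" "\<lambda>y. y / x"]) (use False in \<open>auto simp: U_def\<close>)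
  also have "\<dots> = x ^ card U * (\<Prod>y\<in>U. y)" by (simp add: prod.distrib)
  finally have "x ^ card U = 1" by (simp add: U_def)
  moreover have "CARD('a) = Suc (card U)"
    unfolding U_def by (simp add: card_Diff_singleton Suc_diff_1 card_gt_0_iff)
  ultimately show ?thesis by simp
qed auto

text \<open>\<open>X ^ e - 1\<close> has too few roots to vanish at every nonzero element, so some
  \<open>g \<noteq> 0\<close> has \<open>g ^ e \<noteq> 1\<close>; substituting \<open>g * x\<close>
  for \<open>x\<close> multiplies the sum by \<open>g ^ e\<close>.\<close>

lemma sum_power_finite_field:
  assumes "0 < e" "e < CARD('a) - 1"
  shows "(\<Sum>x\<in>UNIV. x ^ e) = (0::'a::{field,finite})"
proof -
  define P where "P = monom (1::'a) e - 1"
  have "degree P \<le> e" unfolding P_def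
    by (rule degree_diff_le) (auto simp: degree_monom_le)
  moreover have "coeff P e = 1" using assms(1) by (simp add: P_def)
  then have "P \<noteq> 0" by auto
  ultimately have "card {x. poly P x = 0} \<le> e" using card_poly_roots_bound[of P] by linarith
  also have "e < card (UNIV - {0} :: 'a set)" using assms(2) by (simp add: card_Diff_singleton)
  finally have "\<not> UNIV - {0} \<subseteq> {x. poly P x = 0}"
    using card_mono[of "{x. poly P x = 0}" "UNIV - {0}"] by auto
  then obtain g :: 'a where g: "g \<noteq> 0" "g ^ e \<noteq> 1" by (auto simp: P_def poly_monom)
  have "(\<Sum>x\<in>UNIV. x ^ e) = (\<Sum>x\<in>UNIV. (g * x) ^ e)"
    by (rule sum.reindex_bij_witness[of _ "\<lambda>y. g * y" "\<lambda>y. y / g"]) (use g in auto)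
  also have "\<dots> = g ^ e * (\<Sum>x\<in>UNIV. x ^ e)" by (simp add: power_mult_distrib sum_distrib_left)
  finally show ?thesis using g(2) by simp
qed

lemma sum_inverse_finite_field:
  fixes f :: "'a::{field,finite} \<Rightarrow> 'b::comm_monoid_add"
  shows "(\<Sum>x\<in>UNIV. f (inverse x)) = (\<Sum>x\<in>UNIV. f x)"
  by (rule sum.reindex_bij_witness[of _ inverse inverse]) auto

section \<open>Frobenius, the prime field and moments of the trace\<close>

locale prime_power_field =
  fixes p n :: nat and F :: "'a::{field,finite} itself"
  assumes prime: "prime p" and n_pos: "n \<ge> 1" and card_eq: "CARD('a) = p ^ n"
begin

lemma CHAR_eq: "CHAR('a) = p"
proof -
  have pr: "prime CHAR('a)" by (intro prime_CHAR_semidom finite_imp_CHAR_pos) simp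
  moreover have "CHAR('a) dvd p ^ n" using CHAR_dvd_CARD[where 'a = 'a] card_eq by simp
  ultimately show ?thesis using prime prime_dvd_power primes_dvd_imp_eq by metis
qed

lemma of_nat_eq_iff: "of_nat s = (of_nat t :: 'a) \<longleftrightarrow> [s = t] (mod p)"
  by (simp add: of_nat_eq_iff_cong_CHAR CHAR_eq)

lemma frobenius_add: "(x + y :: 'a) ^ (p ^ k) = x ^ (p ^ k) + y ^ (p ^ k)"
  by (rule freshmans_dream') (use prime CHAR_eq in auto)

lemma of_nat_frobenius: "(of_nat t :: 'a) ^ (p ^ k) = of_nat t"
  using prime_gt_0_nat[OF prime]
  by (induction t) (auto simp: frobenius_add power_0_left)

text \<open>The \<open>p\<close> distinct images of the numbers below \<open>p\<close> already
  exhaust the roots of \<open>X ^ p - X\<close>.\<close>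

lemma frobenius_fixed_iff: "x ^ p = x \<longleftrightarrow> (\<exists>t<p. x = (of_nat t :: 'a))"
proof -
  define P where "P = monom (1::'a) p - monom 1 1"
  have p: "p > 1" using prime by (rule prime_gt_1_nat)
  have "degree P \<le> p" unfolding P_def
    by (rule degree_diff_le) (use p in \<open>auto intro: order_trans[OF degree_monom_le]\<close>)
  moreover have "coeff P p = 1" using p by (simp add: P_def)
  then have "P \<noteq> 0" by auto
  ultimately have "card {x. poly P x = 0} \<le> p" using card_poly_roots_bound[of P] by linarith
  moreover have "{x. poly P x = 0} = {x. x ^ p = x}" by (auto simp: P_def poly_monom)
  moreover have "inj_on (of_nat :: nat \<Rightarrow> 'a) {..<p}"
    by (auto intro!: inj_onI simp: of_nat_eq_iff cong_less_modulus_unique_nat)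
  then have "card ((of_nat :: nat \<Rightarrow> 'a) ` {..<p}) = p" by (simp add: card_image)
  moreover have "(of_nat :: nat \<Rightarrow> 'a) ` {..<p} \<subseteq> {x. x ^ p = x}"
    using of_nat_frobenius[of _ 1] by auto
  ultimately have "(of_nat :: nat \<Rightarrow> 'a) ` {..<p} = {x. x ^ p = x}"
    by (intro card_seteq) auto
  then show ?thesis by blast
qed

text \<open>Frobenius shifts the summands by one place, and the new last one,
  \<open>c ^ (p ^ n)\<close>, is the lost first one, \<open>c\<close>.\<close>

lemma abs_trace_frobenius: "abs_trace p n (c :: 'a) ^ p = abs_trace p n c"
proof -
  have "abs_trace p n c ^ p = (\<Sum>k<n. (c ^ (p ^ k)) ^ p)"
    unfolding abs_trace_def by (rule freshmans_dream_sum) (use prime CHAR_eq in auto)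
  also have "\<dots> + c = (\<Sum>k<Suc n. c ^ (p ^ k))"
    by (subst sum.lessThan_Suc_shift) (simp add: add.commute mult.commute flip: power_mult)
  also have "\<dots> = abs_trace p n c + c"
    using finite_field_power_card[of c] by (simp add: abs_trace_def card_eq)
  finally show ?thesis by simp
qed

lemma abs_trace_of_nat_mult: "abs_trace p n (of_nat t * x :: 'a) = of_nat t * abs_trace p n x"
  by (simp add: abs_trace_def power_mult_distrib of_nat_frobenius sum_distrib_left)

text \<open>The trace is fixed by Frobenius, hence lies in the prime field, and the description in
  \<open>prime_field_rep\<close> has exactly one witness.\<close>

lemma of_nat_Tr: "of_nat (Tr p n c) = abs_trace p n (c :: 'a)"
proof -
  obtain t where t: "t < p" "abs_trace p n c = of_nat t"
    using frobenius_fixed_iff abs_trace_frobenius by blast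
  have "prime_field_rep p (abs_trace p n c) = t"
    unfolding prime_field_rep_def using t
    by (intro the_equality) (auto simp: of_nat_eq_iff cong_less_modulus_unique_nat)
  then show ?thesis by (simp add: Tr_def t)
qed

lemma Tr_of_nat_mult_cong: "[Tr p n (of_nat t * c :: 'a) = t * Tr p n c] (mod p)"
  by (simp add: of_nat_Tr abs_trace_of_nat_mult flip: of_nat_eq_iff)

lemma Tr_minus_cong: "[Tr p n (- c :: 'a) = (p - 1) * Tr p n c] (mod p)"
proof -
  have "of_nat (p - 1) = (- 1 :: 'a)"
    using prime_gt_0_nat[OF prime] of_nat_eq_iff[of p 0] by (simp add: of_nat_diff cong_0_iff)
  then show ?thesis using Tr_of_nat_mult_cong[of "p - 1" c] by simp
qed

text \<open>Off the diagonal this is a power sum with exponent strictly between 0 and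
  \<open>p ^ n - 1\<close>, up to swapping \<open>x\<close> and its inverse. On the diagonal it
  counts the \<open>p ^ n - 1\<close> nonzero elements, since the summand at 0 is 0.\<close>

lemma sum_inverse_power_mult_power:
  assumes "i < n" "j < n" "odd p"
  shows "(\<Sum>x\<in>UNIV. inverse x ^ (p ^ i) * x ^ (p ^ j)) = (if i = j then - 1 else 0 :: 'a)"
proof -
  have p: "p > 1" using prime by (rule prime_gt_1_nat)
  have lt: "p ^ l - p ^ k < p ^ n - 1 \<and> 0 < p ^ l - p ^ k" if "k < l" "l < n" for k l
  proof -
    have "p ^ k < p ^ l" "p ^ l < p ^ n" "p ^ k \<ge> 1" using that p by auto
    then show ?thesis by linarith
  qed
  have less: "(\<Sum>x\<in>UNIV. inverse x ^ (p ^ k) * x ^ (p ^ l)) = (0 :: 'a)" if "k < l" "l < n" for k l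
  proof -
    have "inverse x ^ (p ^ k) * x ^ (p ^ l) = x ^ (p ^ l - p ^ k)" for x :: 'a
    proof (cases "x = 0")
      case False
      then show ?thesis using lt[OF that] by (simp add: power_diff field_simps)
    qed (use lt[OF that] p in \<open>simp add: power_0_left\<close>)
    then show ?thesis using lt[OF that] by (simp add: sum_power_finite_field card_eq)
  qed
  consider "i = j" | "i < j" | "j < i" by linarith
  then show ?thesis
  proof cases
    case 1
    have "(\<Sum>x\<in>UNIV. inverse x ^ (p ^ i) * x ^ (p ^ j)) = (\<Sum>x\<in>UNIV - {0 :: 'a}. 1 :: 'a)"
      using 1 p by (intro sum.mono_neutral_cong_right) (auto simp: field_simps)
    also have "\<dots> = of_nat (p ^ n - 1)" by (simp add: card_Diff_singleton card_eq)
    also have "\<dots> = - 1"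
      using p n_pos of_nat_eq_iff[of "p ^ n" 0] by (simp add: of_nat_diff cong_0_iff del: of_nat_power)
    finally show ?thesis using 1 by simp
  next
    case 2
    then show ?thesis using less assms by simp
  next
    case 3
    then show ?thesis
      using less[of j i] assms sum_inverse_finite_field[of "\<lambda>x::'a. inverse x ^ (p ^ j) * x ^ (p ^ i)"]
      by (simp add: mult.commute)
  qed
qed

text \<open>In the expanded square, products of two powers of \<open>x\<close>, or of two powers of
  its inverse, sum to 0. The mixed products survive only for \<open>i = j\<close>, where they
  contribute \<open>- 2 * a ^ (p ^ i)\<close>.\<close>

lemma sum_abs_trace_square:
  assumes "odd p" "p ^ n \<noteq> 3"
  shows "(\<Sum>x\<in>UNIV. (abs_trace p n (inverse x + a * x :: 'a))\<^sup>2) = - 2 * abs_trace p n a"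
proof -
  have p: "p \<ge> 3" using prime_ge_2_nat[OF prime] assms(1) by (cases "p = 2") auto
  have pow: "(\<Sum>x\<in>UNIV. x ^ (p ^ i) * x ^ (p ^ j)) = (0 :: 'a)" if "i < n" "j < n" for i j
  proof -
    define r where "r = p ^ (n - 1)"
    have "p ^ i \<le> r" "p ^ j \<le> r" unfolding r_def using that p by (auto intro!: power_increasing)
    moreover have pr: "p ^ n = p * r" using n_pos by (simp add: r_def flip: power_Suc)
    \<comment> \<open>The largest exponent \<open>2 * r\<close> has to stay below
      \<open>p ^ n - 1\<close>; for odd \<open>p\<close> this fails exactly when
      \<open>p ^ n = 3\<close>.\<close>
    moreover have "r + r < p * r - 1"
    proof (cases "n = 1")
      case True
      then have "p > 3" "r = 1" using assms p by (auto simp: r_def)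
      moreover have "p \<noteq> 4" using assms by auto
      ultimately show ?thesis by simp
    next
      case False
      then have "r > 1" using p n_pos unfolding r_def by (intro one_less_power) auto
      moreover have "3 * r \<le> p * r" using p by simp
      ultimately show ?thesis by linarith
    qed
    ultimately have "p ^ i + p ^ j < p ^ n - 1" by linarith
    then show ?thesis using p by (simp add: sum_power_finite_field card_eq flip: power_add)
  qed
  define M where "M i j = (\<Sum>x\<in>UNIV. inverse x ^ (p ^ i) * x ^ (p ^ j) :: 'a)" for i j
  have M: "M i j = (if i = j then - 1 else 0)" if "i < n" "j < n" for i j
    unfolding M_def by (rule sum_inverse_power_mult_power[OF that assms(1)])
  have inner: "(\<Sum>x\<in>UNIV. (inverse x + a * x) ^ (p ^ i) * (inverse x + a * x) ^ (p ^ j))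
      = a ^ (p ^ j) * M i j + a ^ (p ^ i) * M j i" if ij: "i < n" "j < n" for i j
  proof -
    have "(\<Sum>x\<in>UNIV. (inverse x + a * x) ^ (p ^ i) * (inverse x + a * x) ^ (p ^ j)) =
      (\<Sum>x\<in>UNIV. inverse x ^ (p ^ i) * inverse x ^ (p ^ j)) + a ^ (p ^ j) * M i j + a ^ (p ^ i) * M j i
        + a ^ (p ^ i) * a ^ (p ^ j) * (\<Sum>x\<in>UNIV. x ^ (p ^ i) * x ^ (p ^ j))"
      unfolding M_def sum_distrib_left sum.distrib[symmetric]
      by (rule sum.cong) (simp_all only: frobenius_add power_mult_distrib ring_distribs mult_ac add_ac)
    then show ?thesis
      using pow[OF ij] sum_inverse_finite_field[of "\<lambda>x::'a. x ^ (p ^ i) * x ^ (p ^ j)"] by simp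
  qed
  have "(\<Sum>x\<in>UNIV. (abs_trace p n (inverse x + a * x))\<^sup>2) =
      (\<Sum>i<n. \<Sum>j<n. \<Sum>x\<in>UNIV. (inverse x + a * x) ^ (p ^ i) * (inverse x + a * x) ^ (p ^ j))"
    unfolding abs_trace_def power2_eq_square sum_product
    by (subst sum.swap, rule sum.cong[OF refl], subst sum.swap, rule refl)
  also have "\<dots> = (\<Sum>i<n. \<Sum>j<n. if i = j then - 2 * a ^ (p ^ i) else 0)"
    by (intro sum.cong refl) (auto simp: inner M)
  also have "\<dots> = - 2 * abs_trace p n a"
    by (simp add: abs_trace_def sum_distrib_left)
  finally show ?thesis .
qed

lemma sum_Tr_square_cong:
  assumes "odd p" "p ^ n \<noteq> 3"
  shows "p dvd (\<Sum>x\<in>UNIV. (Tr p n (inverse x + a * x :: 'a))\<^sup>2) + 2 * Tr p n a"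
proof -
  have "of_nat ((\<Sum>x\<in>UNIV. (Tr p n (inverse x + a * x :: 'a))\<^sup>2) + 2 * Tr p n a) = (of_nat 0 :: 'a)"
    using sum_abs_trace_square[OF assms, of a] by (simp add: of_nat_Tr)
  then show ?thesis by (simp only: of_nat_eq_iff cong_0_iff)
qed

end

section \<open>Kloosterman sums\<close>

context prime_power_field
begin

abbreviation kl_exponent :: "'a \<Rightarrow> 'a \<Rightarrow> nat" where
  "kl_exponent a x \<equiv> Tr p n (inverse x + a * x)"

text \<open>The Kloosterman sum as a polynomial in the root of unity, so that its conjugates are
  values of one function.\<close>

definition kl_fun :: "'a \<Rightarrow> complex \<Rightarrow> complex" where
  "kl_fun a z = (\<Sum>x\<in>UNIV. z ^ kl_exponent a x)"

text \<open>Substituting \<open>x / i\<close> for \<open>x\<close> turns the argument of the trace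
  into \<open>i * (inverse x + a * x)\<close>, and the trace is linear over the prime field.\<close>

lemma kloosterman_square_mult:
  assumes "\<zeta> ^ p = 1" "\<not> p dvd i"
  shows "kloosterman p n \<zeta> (of_nat (i\<^sup>2) * a) = kl_fun a (\<zeta> ^ i)"
proof -
  have i: "of_nat i \<noteq> (0 :: 'a)" using assms(2) of_nat_eq_iff[of i 0] by (simp add: cong_0_iff)
  have "kloosterman p n \<zeta> (of_nat (i\<^sup>2) * a) = (\<Sum>x\<in>UNIV. \<zeta> ^ Tr p n (of_nat i * (inverse x + a * x)))"
    unfolding kloosterman_def
    by (rule sum.reindex_bij_witness[of _ "\<lambda>x. x / of_nat i" "\<lambda>x. of_nat i * x"])
       (use i in \<open>auto simp: power2_eq_square field_simps\<close>)
  also have "\<dots> = kl_fun a (\<zeta> ^ i)"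
    unfolding kl_fun_def power_mult[symmetric]
    by (intro sum.cong refl root_of_unity_power_cong[OF assms(1)] Tr_of_nat_mult_cong)
  finally show ?thesis .
qed

text \<open>\<open>z ^ (p - 1)\<close> is the inverse of \<open>z\<close>, and replacing
  \<open>x\<close> by \<open>- x\<close> negates the exponent modulo \<open>p\<close>.\<close>

lemma kl_fun_conj:
  assumes "z ^ p = 1"
  shows "kl_fun a (z ^ (p - 1)) = kl_fun a z"
proof -
  have "kl_fun a (z ^ (p - 1)) = (\<Sum>x\<in>UNIV. z ^ Tr p n (- (inverse x + a * x)))"
    unfolding kl_fun_def power_mult[symmetric]
    by (intro sum.cong refl root_of_unity_power_cong[OF assms] cong_sym[OF Tr_minus_cong])
  also have "\<dots> = kl_fun a z"
    unfolding kl_fun_def by (rule sum.reindex_bij_witness[of _ uminus uminus]) (auto simp: add.commute)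
  finally show ?thesis .
qed

text \<open>Here \<open>p\<^sup>n \<noteq> 3\<close> enters: \<open>p\<close> is the product of all \<open>1 - z\<^sup>k\<close> with \<open>0 < k < p\<close>, and once \<open>k = 1\<close> and
  \<open>k = p - 1\<close> are removed, \<open>p\<^sup>n\<close> keeps a factor \<open>1 - z\<^sup>k\<close> (if \<open>p > 3\<close>) or \<open>p\<close> (if \<open>n > 1\<close>).\<close>
lemma card_eq_mult_cyclotomic_uniformizer:
  assumes "odd p" "p ^ n \<noteq> 3"
  obtains Q u where "int_poly_fun Q" "Q 1 = of_int (int p * u)"
    "\<And>z. z ^ p = 1 \<Longrightarrow> z \<noteq> 1 \<Longrightarrow> of_nat (p ^ n) = (1 - z) * (1 - z ^ (p - 1)) * Q z"
proof -
  have p: "p \<ge> 3" using prime_ge_2_nat[OF prime] assms(1) by (cases "p = 2") auto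
  define Q where "Q z = of_nat (p ^ (n - 1)) * (\<Prod>k=2..p-2. 1 - z ^ k)" for z :: complex
  have "int_poly_fun Q" unfolding Q_def
    by (intro int_poly_fun_mult int_poly_fun_const int_poly_fun_prod int_poly_fun_diff
        int_poly_fun_power int_poly_fun_ident) auto
  moreover have "\<exists>u. Q 1 = of_int (int p * u)"
  \<comment> \<open>For \<open>p = 3\<close> the product in \<open>Q\<close> is empty and equals 1,
    so the factor \<open>p\<close> comes from \<open>p ^ (n - 1)\<close>; otherwise the product
    vanishes at 1.\<close>
  proof (cases "p = 3")
    case True
    then have "n \<ge> 2" using assms(2) n_pos by (cases "n = 1") auto
    then have "n - 1 = Suc (n - 2)" by simp
    then have "p ^ (n - 1) = p * p ^ (n - 2)" by (simp only: power_Suc)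
    then show ?thesis using True by (intro exI[of _ "int (p ^ (n - 2))"]) (simp add: Q_def)
  next
    case False
    moreover have "p \<noteq> 4" using assms(1) by auto
    ultimately have "Q 1 = 0" using p by (auto simp: Q_def)
    then show ?thesis by (intro exI[of _ 0]) simp
  qed
  moreover have "of_nat (p ^ n) = (1 - z) * (1 - z ^ (p - 1)) * Q z" if "z ^ p = 1" "z \<noteq> 1" for z
  proof -
    have "{1..p-1} = insert 1 (insert (p - 1) {2..p-2})" using p by auto
    moreover have "1 \<notin> insert (p - 1) {2..p-2}" "p - 1 \<notin> {2..p-2}" using p by auto
    ultimately have "(\<Prod>k=1..p-1. 1 - z ^ k) = (1 - z) * ((1 - z ^ (p - 1)) * (\<Prod>k=2..p-2. 1 - z ^ k))"
      by (simp del: One_nat_def)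
    then have "(1 - z) * (1 - z ^ (p - 1)) * Q z = of_nat (p ^ (n - 1)) * of_nat p"
      using prod_one_minus_root_of_unity[OF prime that] by (simp add: Q_def mult_ac)
    also have "\<dots> = of_nat (p ^ n)" using n_pos by (simp flip: of_nat_mult power_Suc2)
    finally show ?thesis by simp
  qed
  ultimately show ?thesis using that by blast
qed

text \<open>By evenness, twice the Kloosterman sum is \<open>2 p\<^sup>n - (\<Sum>x. (1 - z\<^sup>t) (1 - z\<^bsup>-t\<^esup>))\<close> with \<open>t\<close> the exponent at \<open>x\<close>.\<close>
lemma kl_fun_factorization:
  assumes "odd p" "p ^ n \<noteq> 3"
  obtains H s where "int_poly_fun H" "H 1 = of_int s" "[s = 2 * int (Tr p n a)] (mod int p)"
    "\<And>z. z ^ p = 1 \<Longrightarrow> z \<noteq> 1 \<Longrightarrow> 2 * kl_fun a z = (1 - z) * (1 - z ^ (p - 1)) * H z"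
proof -
  obtain Q u where Q: "int_poly_fun Q" "Q 1 = of_int (int p * u)"
    "\<And>z. z ^ p = 1 \<Longrightarrow> z \<noteq> 1 \<Longrightarrow> of_nat (p ^ n) = (1 - z) * (1 - z ^ (p - 1)) * Q z"
    using card_eq_mult_cyclotomic_uniformizer[OF assms] by blast
  \<comment> \<open>\<open>U t z\<close> is \<open>(1 - z ^ t) / (1 - z)\<close> in polynomial form;
    its value \<open>t\<close> at 1 produces the squared exponents in \<open>s\<close>.\<close>
  define U :: "nat \<Rightarrow> complex \<Rightarrow> complex" where "U t z = (\<Sum>k<t. z ^ k)" for t z
  define H where "H z = 2 * Q z - (\<Sum>x\<in>UNIV. U (kl_exponent a x) z * U (kl_exponent a x) (z ^ (p - 1)))" for z
  define s where "s = 2 * (int p * u) - int (\<Sum>x\<in>UNIV. (kl_exponent a x)\<^sup>2)"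
  have "int_poly_fun H"
    unfolding H_def U_def using Q(1)
    by (intro int_poly_fun_mult int_poly_fun_const int_poly_fun_sum int_poly_fun_diff
        int_poly_fun_power int_poly_fun_ident) auto
  moreover have "H 1 = of_int s"
    by (simp add: H_def U_def s_def Q(2) power2_eq_square)
  moreover have "[s = 2 * int (Tr p n a)] (mod int p)"
  proof -
    have "int p dvd int ((\<Sum>x\<in>UNIV. (kl_exponent a x)\<^sup>2) + 2 * Tr p n a)"
      using sum_Tr_square_cong[OF assms] by (simp only: int_dvd_int_iff)
    then have "int p dvd 2 * (int p * u) - int ((\<Sum>x\<in>UNIV. (kl_exponent a x)\<^sup>2) + 2 * Tr p n a)"
      by (intro dvd_diff) auto
    then show ?thesis by (simp add: cong_iff_dvd_diff s_def algebra_simps)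
  qed
  moreover have "2 * kl_fun a z = (1 - z) * (1 - z ^ (p - 1)) * H z" if z: "z ^ p = 1" "z \<noteq> 1" for z
  proof -
    have fac: "(1 - z) * (1 - z ^ (p - 1)) * (U t z * U t (z ^ (p - 1)))
        = 2 - (z ^ t + (z ^ (p - 1)) ^ t)" for t
    proof -
      have U: "(1 - y) * U t y = 1 - y ^ t" for y
        by (cases t) (simp_all add: U_def sum_gp_basic lessThan_Suc_atMost)
      have "z ^ t * (z ^ (p - 1)) ^ t = (z * z ^ (p - 1)) ^ t" by (simp add: power_mult_distrib)
      also have "z * z ^ (p - 1) = 1"
        using z(1) prime_gt_0_nat[OF prime] by (simp flip: power_Suc)
      finally have "(1 - z ^ t) * (1 - (z ^ (p - 1)) ^ t) = 2 - (z ^ t + (z ^ (p - 1)) ^ t)"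
        by (simp add: algebra_simps)
      then show ?thesis unfolding U[symmetric] by (simp only: mult_ac)
    qed
    have "(1 - z) * (1 - z ^ (p - 1)) * H z = 2 * of_nat (p ^ n)
        - (\<Sum>x\<in>UNIV. (1 - z) * (1 - z ^ (p - 1)) * (U (kl_exponent a x) z * U (kl_exponent a x) (z ^ (p - 1))))"
      unfolding H_def sum_distrib_left[symmetric] Q(3)[OF z] by (simp only: right_diff_distrib mult_ac)
    also have "\<dots> = kl_fun a z + kl_fun a (z ^ (p - 1))"
      unfolding fac by (simp add: sum_subtractf sum.distrib kl_fun_def card_eq)
    finally show ?thesis using kl_fun_conj[OF z(1), of a] by simp
  qed
  ultimately show ?thesis using that by blast
qed

end

section \<open>The norm of the Kloosterman sum and Euler's criterion\<close>

theorem theorem1p1: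
  fixes p n :: nat and \<zeta> :: complex and a :: "'a::{field,finite}"
  assumes "prime p" and "odd p" and "n \<ge> 1"
    and "CARD('a) = p ^ n" and "p ^ n \<noteq> 3"
    and "primitive_root_of_unity p \<zeta>"
  shows "\<exists>m::int.
           (\<Prod>i=1..(p - 1) div 2. kloosterman p n \<zeta> (of_nat (i\<^sup>2) * a)) = of_int m
         \<and> [m = int p * Legendre (int (Tr p n a)) (int p)] (mod (int p)\<^sup>2)"
proof -
  interpret prime_power_field p n "TYPE('a)" using assms by unfold_locales auto
  define h where "h = (p - 1) div 2"
  define t where "t = int (Tr p n a)"
  have p: "p > 2" using prime_ge_2_nat[OF assms(1)] assms(2) by (cases "p = 2") auto
  have \<zeta>: "\<zeta> ^ p = 1" "\<zeta> \<noteq> 1"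
    using assms(6) p unfolding primitive_root_of_unity_def by (auto dest: spec[of _ 1])
  obtain H s where H: "int_poly_fun H" "H 1 = of_int s" and s: "[s = 2 * t] (mod int p)"
    and fH: "\<And>z. z ^ p = 1 \<Longrightarrow> z \<noteq> 1 \<Longrightarrow> 2 * kl_fun a z = (1 - z) * (1 - z ^ (p - 1)) * H z"
    using kl_fun_factorization[OF assms(2,5)] unfolding t_def by metis
  have f: "int_poly_fun (kl_fun a)" unfolding kl_fun_def
    by (intro int_poly_fun_sum int_poly_fun_power int_poly_fun_ident)
  \<comment> \<open>The constant is \<open>c = 2\<close> because the factorization is for twice the
    Kloosterman sum; the resulting \<open>2 ^ h\<close> is cancelled at the end, being prime to
    \<open>p\<close>.\<close>
  obtain m where m: "(\<Prod>i=1..h. kl_fun a (\<zeta> ^ i)) = of_int m"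
    and cong: "[2 ^ h * m = int p * s ^ h] (mod (int p)\<^sup>2)"
    using int_poly_fun_norm_cong[OF assms(1,2) \<zeta> f H(1) kl_fun_conj _ H(2), of 2] fH
    unfolding h_def by auto
  have "(\<Prod>i=1..h. kloosterman p n \<zeta> (of_nat (i\<^sup>2) * a)) = of_int m"
    unfolding m[symmetric]
    by (intro prod.cong refl kloosterman_square_mult[OF \<zeta>(1)]) (auto simp: h_def dest!: dvd_imp_le)
  moreover have "[m = int p * Legendre t (int p)] (mod (int p)\<^sup>2)"
  proof -
    have "[s ^ h = 2 ^ h * t ^ h] (mod int p)"
      using cong_pow[OF s, of h] by (simp add: power_mult_distrib)
    moreover have "[Legendre t (int p) = t ^ h] (mod int p)"
      unfolding h_def using assms(1) p by (intro euler_criterion) auto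
    ultimately have "[s ^ h = 2 ^ h * Legendre t (int p)] (mod int p)"
      by (meson cong_scalar_left cong_sym cong_trans)
    \<comment> \<open>The extra factor \<open>p\<close> lifts Euler's congruence from modulus
      \<open>p\<close> to modulus \<open>p ^ 2\<close>.\<close>
    then have "[int p * s ^ h = int p * (2 ^ h * Legendre t (int p))] (mod int p * int p)"
      by (auto simp: cong_iff_dvd_diff simp flip: right_diff_distrib)
    then have "[2 ^ h * m = 2 ^ h * (int p * Legendre t (int p))] (mod (int p)\<^sup>2)"
      using cong_trans[OF cong] by (simp add: power2_eq_square mult_ac)
    moreover have "coprime (2 ^ h) ((int p)\<^sup>2)" using assms(2) by (simp add: coprime_left_2_iff_odd)
    ultimately show ?thesis by (simp add: cong_mult_lcancel)
  qed
  ultimately show ?thesis unfolding h_def t_def by blast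
qed

end
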